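(* Let $f\in\mathcal{A}$. (i) Suppose that $\frac{zf'(z)}{f(z)}$ and $1+\frac{zf''(z)}{f'(z)}$ are analytic in $\mathbb{D}$. If \[\left| \frac{zf'(z)}{f(z)} \left[ 2-2\frac{zf'(z)}{f(z)}+\frac{zf''(z)}{f'(z)} \right] \right| < \frac12 \quad\text{for all } z\in\mathbb{D},\] then $f\in\mathcal{S}^*$. (ii) Suppose that $1+\frac{zf''(z)}{f'(z)}$ is analytic in $\mathbb{D}$. If \[\left| \frac{z^2f'''(z)}{f'(z)} - 2\left[ \frac{zf''(z)}{f'(z)} \right]^2 \right| < \frac12 \quad\text{for all } z\in\mathbb{D},\] then $f\in\mathcal{K}$. (iii) If \[\left| zf''(z) + f'(z) - (f'(z))^2 \right| < \frac12 \quad\text{for all } z\in\mathbb{D},\] then $\operatorname{Re} f'(z)>0$ for all $z\in\mathbb{D}$. (iv) If \[\left| f'(z) - \left[ \frac{f(z)}{z} \right]^2 \right| < \frac12 \quad\text{for all } z\in\mathbb{D},\] then $\operatorname{Re}\frac{f(z)}{z}>0$ for all $z\in\mathbb{D}$.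
   Context: $\mathbb{D}=\{z\in\mathbb{C}:|z|<1\}$ is the open unit disk. $\mathcal{A}$ is the class of functions $f$ analytic in $\mathbb{D}$ with $f(0)=0$ and $f'(0)=1$. The classes of starlike and convex functions are $\mathcal{S}^*=\{f\in\mathcal{A}: \operatorname{Re}\frac{zf'(z)}{f(z)}>0 \text{ for all } z\in\mathbb{D}\}$ and $\mathcal{K}=\{f\in\mathcal{A}: \operatorname{Re}\left[1+\frac{zf''(z)}{f'(z)}\right]>0 \text{ for all } z\in\mathbb{D}\}$. At $z=0$ the quotients $\frac{zf'(z)}{f(z)}$ and $\frac{f(z)}{z}$ are given their limiting value $1$. Saying that $\frac{zf'(z)}{f(z)}$ is analytic in $\mathbb{D}$ means that $f(z)\neq0$ for $z\in\mathbb{D}\setminus\{0\}$, and saying that $1+\frac{zf''(z)}{f'(z)}$ is analytic in $\mathbb{D}$ means that $f'(z)\ne 0$ for $z\in\mathbb{D}$. *)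

theory Defs
  imports "HOL-Complex_Analysis.Complex_Analysis"
begin

abbreviation unit_disk :: "complex set" where
  "unit_disk \<equiv> ball 0 1"

definition normalized_analytic :: "(complex \<Rightarrow> complex) set" where
  "normalized_analytic = {f. f analytic_on unit_disk \<and> f 0 = 0 \<and> deriv f 0 = 1}"

text \<open>For normalized \<open>f\<close> the quotients \<open>z f'(z) / f(z)\<close> and \<open>f(z) / z\<close> have a removable
  singularity at the origin, with limit 1 there; HOL's \<open>x / 0 = 0\<close> would give the value 0.\<close>

definition log_deriv_quot :: "(complex \<Rightarrow> complex) \<Rightarrow> complex \<Rightarrow> complex" where
  "log_deriv_quot f z = (if z = 0 then 1 else z * deriv f z / f z)"

definition origin_quot :: "(complex \<Rightarrow> complex) \<Rightarrow> complex \<Rightarrow> complex" where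
  "origin_quot f z = (if z = 0 then 1 else f z / z)"

text \<open>The non-vanishing conditions say that the quotients are defined on the disk. In the convex
  case this is not redundant: at a zero of \<open>f'\<close>, HOL would evaluate
  \<open>1 + z f''(z) / f'(z)\<close> to 1.\<close>

definition starlike_functions :: "(complex \<Rightarrow> complex) set" where
  "starlike_functions = {f \<in> normalized_analytic.
     (\<forall>z\<in>unit_disk - {0}. f z \<noteq> 0) \<and>
     (\<forall>z\<in>unit_disk. Re (log_deriv_quot f z) > 0)}"

definition convex_functions :: "(complex \<Rightarrow> complex) set" where
  "convex_functions = {f \<in> normalized_analytic.
     (\<forall>z\<in>unit_disk. deriv f z \<noteq> 0) \<and>
     (\<forall>z\<in>unit_disk. Re (1 + z * (deriv ^^ 2) f z / deriv f z) > 0)}"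

end

theory Submission
  imports Defs
begin

text \<open>All four parts are one statement about a function \<open>p\<close> holomorphic on the disk with
  \<open>p(0) = 1\<close>: if \<open>\<bar>z p' + p - p\<^sup>2\<bar> < 1 / 2\<close> throughout the disk, then \<open>Re p > 0\<close> there
  (\<open>Re_pos_if_norm_diff_expr_less\<close>). The choices of \<open>p\<close> are \<open>z f' / f\<close>, \<open>1 + z f'' / f'\<close>,
  \<open>f'\<close> and \<open>f / z\<close>; in each case \<open>z p' + p - p\<^sup>2\<close> works out to be exactly the expression that is
  assumed to be small.

  For the statement about \<open>p\<close>, suppose that \<open>Re p\<close> fails to be positive somewhere, and let
  \<open>\<zeta>\<close> be a point of least modulus where this happens. Then \<open>p(\<zeta>) = \<i> a\<close> is purely imaginary, and
  the derivative of \<open>p\<close> at \<open>\<zeta>\<close> is constrained in two directions. Along the circle through \<open>\<zeta>\<close>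
  the function \<open>Re p\<close> has a minimum at \<open>\<zeta>\<close>, so \<open>\<zeta> p'(\<zeta>)\<close> is real. Along the radius, the Schwarz
  lemma for the Cayley transform \<open>(p - 1) / (p + 1)\<close> bounds \<open>Re p\<close> from below, so \<open>Re p\<close> can
  reach 0 at \<open>\<zeta>\<close> only with a certain slope: \<open>\<zeta> p'(\<zeta>) \<le> - (1 + a\<^sup>2) / 2\<close>. This is the lemma of
  Jack and of Miller and Mocanu (\<open>first_imaginary_point\<close>).

  Hence \<open>z p' + p - p\<^sup>2\<close> has at \<open>\<zeta>\<close> the imaginary part \<open>a\<close> and a real part of at most
  \<open>- (1 - a\<^sup>2) / 2\<close>. Its modulus is at least \<open>\<bar>a\<bar> \<ge> 1\<close> if \<open>a\<^sup>2 \<ge> 1\<close>, and otherwise at least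
  \<open>(1 + a\<^sup>2) / 2\<close>, since \<open>((1 - a\<^sup>2) / 2)\<^sup>2 + a\<^sup>2 = ((1 + a\<^sup>2) / 2)\<^sup>2\<close>. Both contradict the bound
  \<open>1 / 2\<close>.\<close>

section \<open>Functions with positive real part\<close>

text \<open>The Cayley transform \<open>w \<mapsto> (w - 1) / (w + 1)\<close> maps the right half-plane to the unit disk and
  1 to 0, so this is the Schwarz lemma for the Cayley transform of \<open>u \<mapsto> p(c u)\<close>. The denominator
  is cleared so that the inequality can be differentiated along a radius without a quotient.\<close>

lemma Schwarz_positive_real_part:
  fixes p :: "complex \<Rightarrow> complex"
  assumes hol: "p holomorphic_on ball 0 r" and p0: "p 0 = 1"
    and pos: "\<And>z. z \<in> ball 0 r \<Longrightarrow> Re (p z) > 0"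
    and c: "norm c = r" and u: "norm u < 1"
  shows "norm (p (c * u) - 1) \<le> norm u * norm (p (c * u) + 1)"
proof (cases "r = 0")
  case True
  then show ?thesis using c p0 by auto
next
  case False
  then have r: "r > 0" using c by auto
  define W where "W = (\<lambda>u. (p (c * u) - 1) / (p (c * u) + 1))"
  have in_ball: "c * v \<in> ball 0 r" if "norm v < 1" for v
    using that r c by (simp add: norm_mult)
  have nz: "p (c * v) + 1 \<noteq> 0" if "norm v < 1" for v
  proof
    assume "p (c * v) + 1 = 0"
    then have "Re (p (c * v) + 1) = 0" by simp
    with pos[OF in_ball[OF that]] show False by simp
  qed
  have "(p \<circ> (\<lambda>u. c * u)) holomorphic_on ball 0 1"
    by (rule holomorphic_on_compose_gen[OF _ hol])
      (use in_ball in \<open>auto intro!: holomorphic_intros\<close>)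
  then have "W holomorphic_on ball 0 1"
    unfolding W_def o_def using nz by (intro holomorphic_intros) auto
  moreover have "W 0 = 0" by (simp add: W_def p0)
  moreover have "norm (W v) < 1" if "norm v < 1" for v
  proof -
    have "(norm (p (c * v) - 1))\<^sup>2 < (norm (p (c * v) + 1))\<^sup>2"
      using pos[OF in_ball[OF that]]
      unfolding cmod_power2 by (simp add: power2_eq_square algebra_simps)
    then have "norm (p (c * v) - 1) < norm (p (c * v) + 1)"
      by (rule power2_less_imp_less) simp
    then show ?thesis using nz[OF that] by (simp add: W_def norm_divide)
  qed
  ultimately have "norm (W u) \<le> norm u"
    using u by (intro Schwarz_Lemma(1))
  then show ?thesis using nz[OF u] by (simp add: W_def norm_divide field_simps)
qed

lemma Re_nonneg_on_circle:
  fixes p :: "complex \<Rightarrow> complex"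
  assumes cont: "continuous_on A p" and A: "open A" "z \<in> A" and z: "z \<noteq> 0"
    and pos: "\<And>w. norm w < norm z \<Longrightarrow> Re (p w) > 0"
  shows "Re (p z) \<ge> 0"
proof -
  have "isCont p (of_real 1 * z)" using cont A by (simp add: continuous_on_eq_continuous_at)
  then have "((\<lambda>t. p (of_real t * z)) \<longlongrightarrow> p (of_real 1 * z)) (at_left (1::real))"
    by (rule isCont_tendsto_compose) (intro tendsto_intros)
  then have "((\<lambda>t. Re (p (of_real t * z))) \<longlongrightarrow> Re (p (of_real 1 * z))) (at_left (1::real))"
    by (rule tendsto_Re)
  moreover have "\<forall>\<^sub>F t in at_left (1::real). 0 \<le> Re (p (of_real t * z))"
  proof (rule eventually_at_leftI[of 0])
    fix t :: real assume "t \<in> {0<..<1}"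
    then have "norm (of_real t * z) < norm z" using z by (simp add: norm_mult)
    from pos[OF this] show "0 \<le> Re (p (of_real t * z))" by simp
  qed simp
  ultimately have "0 \<le> Re (p (of_real 1 * z))"
    by (rule tendsto_lowerbound) simp
  then show ?thesis by simp
qed

text \<open>The tangential condition holds because \<open>Re p\<close> is minimal at \<open>c\<close> among the points of the circle
  through \<open>c\<close>. For the radial one, write the Schwarz inequality at the point \<open>t c\<close> as
  \<open>t\<^sup>2 \<bar>p + 1\<bar>\<^sup>2 - \<bar>p - 1\<bar>\<^sup>2 \<ge> 0\<close>. At \<open>t = 1\<close> the left side is \<open>4 Re p(c) = 0\<close>, so its derivative
  there, which is \<open>2 (1 + (Im p(c))\<^sup>2) + 4 Re (c p'(c))\<close>, cannot be positive.\<close>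

lemma first_imaginary_point:
  fixes p :: "complex \<Rightarrow> complex"
  assumes hol: "p holomorphic_on A" "open A" and A: "cball 0 (norm c) \<subseteq> A" and p0: "p 0 = 1"
    and pos: "\<And>z. norm z < norm c \<Longrightarrow> Re (p z) > 0" and pc: "Re (p c) = 0"
  shows "Im (c * deriv p c) = 0" "Re (c * deriv p c) \<le> - (1 + (Im (p c))\<^sup>2) / 2"
proof -
  have nc: "c \<noteq> 0" using p0 pc by auto
  have cA: "c \<in> A" using A by auto
  have ball: "ball 0 (norm c) \<subseteq> A" using A ball_subset_cball by blast
  have dp: "(p has_field_derivative deriv p c) (at c)"
    using hol cA by (simp add: holomorphic_derivI)
  have contp: "continuous_on A p" using hol(1) by (rule holomorphic_on_imp_continuous_on)
  have nonneg: "Re (p z) \<ge> 0" if "norm z = norm c" for z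
    by (rule Re_nonneg_on_circle[OF contp hol(2)]) (use that A pos nc in auto)
  show "Im (c * deriv p c) = 0"
  proof -
    have "((\<lambda>t. c * exp (\<i> * of_real t)) has_vector_derivative c * \<i>) (at (0::real))"
      by (auto intro!: derivative_eq_intros has_vector_derivative_real_field)
    moreover have "(p has_field_derivative deriv p c) (at (c * exp (\<i> * of_real 0)))"
      using dp by simp
    ultimately have "((p \<circ> (\<lambda>t. c * exp (\<i> * of_real t))) has_vector_derivative
        (c * \<i>) * deriv p c) (at (0::real))"
      by (intro field_vector_diff_chain_at)
    then have "((\<lambda>t. Re (p (c * exp (\<i> * of_real t)))) has_real_derivative
        Re ((c * \<i>) * deriv p c)) (at (0::real))"
      unfolding has_real_derivative_iff_has_vector_derivative o_def
      by (rule bounded_linear.has_vector_derivative[OF bounded_linear_Re])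
    then have "Re ((c * \<i>) * deriv p c) = 0"
    proof (rule DERIV_local_min[of _ _ _ 1])
      show "\<forall>t. \<bar>0 - t\<bar> < 1 \<longrightarrow>
          Re (p (c * exp (\<i> * of_real 0))) \<le> Re (p (c * exp (\<i> * of_real t)))"
        using nonneg pc by (simp add: norm_mult)
    qed simp
    then show ?thesis by (simp add: algebra_simps)
  qed
  show "Re (c * deriv p c) \<le> - (1 + (Im (p c))\<^sup>2) / 2"
  proof -
    define g where "g = (\<lambda>t::real. t\<^sup>2 * (norm (p (c * of_real t) + 1))\<^sup>2
      - (norm (p (c * of_real t) - 1))\<^sup>2)"
    define D where "D = 2 * (1 + (Im (p c))\<^sup>2) + 4 * Re (c * deriv p c)"
    have "((\<lambda>t. c * of_real t) has_vector_derivative c) (at (1::real))"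
      by (auto intro!: derivative_eq_intros has_vector_derivative_real_field)
    moreover have "(p has_field_derivative deriv p c) (at (c * of_real 1))"
      using dp by simp
    ultimately have path: "((p \<circ> (\<lambda>t. c * of_real t)) has_vector_derivative c * deriv p c) (at (1::real))"
      by (intro field_vector_diff_chain_at)
    have dRe: "((\<lambda>t. Re (p (c * of_real t))) has_real_derivative Re (c * deriv p c)) (at (1::real))"
      using path unfolding has_real_derivative_iff_has_vector_derivative o_def
      by (rule bounded_linear.has_vector_derivative[OF bounded_linear_Re])
    have dIm: "((\<lambda>t. Im (p (c * of_real t))) has_real_derivative Im (c * deriv p c)) (at (1::real))"
      using path unfolding has_real_derivative_iff_has_vector_derivative o_def
      by (rule bounded_linear.has_vector_derivative[OF bounded_linear_Im])
    have g1: "g 1 = 0" using pc by (simp add: g_def cmod_power2)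
    have der: "(g has_real_derivative D) (at 1)"
      unfolding g_def cmod_power2 plus_complex.sel minus_complex.sel one_complex.sel
      by (rule derivative_eq_intros dRe dIm refl)+
        (simp add: D_def pc algebra_simps power2_eq_square)
    have nn: "g t \<ge> 0" if t: "0 < t" "t < 1" for t
    proof -
      have "norm (p (c * of_real t) - 1) \<le> norm (of_real t :: complex) * norm (p (c * of_real t) + 1)"
        by (rule Schwarz_positive_real_part[OF holomorphic_on_subset[OF hol(1) ball]])
          (use pos p0 t in auto)
      then have "(norm (p (c * of_real t) - 1))\<^sup>2 \<le> (t * norm (p (c * of_real t) + 1))\<^sup>2"
        using t by (intro power_mono) auto
      then show ?thesis by (simp add: g_def power_mult_distrib)
    qed
    have "D \<le> 0"
    proof (rule ccontr)
      assume "\<not> D \<le> 0"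
      then obtain d where d: "d > 0" "\<And>h. 0 < h \<Longrightarrow> h < d \<Longrightarrow> g (1 - h) < g 1"
        using DERIV_pos_inc_left[OF der] by auto
      define h where "h = min (d / 2) (1 / 2)"
      have "0 < h" "h < d" "h < 1" using d(1) by (auto simp: h_def)
      with d(2)[of h] nn[of "1 - h"] g1 show False by auto
    qed
    then show ?thesis by (simp add: D_def)
  qed
qed

theorem Re_pos_if_norm_diff_expr_less:
  fixes p :: "complex \<Rightarrow> complex"
  assumes hol: "p holomorphic_on ball 0 1" and p0: "p 0 = 1"
    and small: "\<And>z. z \<in> ball 0 1 \<Longrightarrow> norm (z * deriv p z + p z - (p z)\<^sup>2) < 1 / 2"
    and z: "z \<in> ball 0 1"
  shows "Re (p z) > 0"
proof (rule ccontr)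
  assume neg: "\<not> Re (p z) > 0"
  have contp: "continuous_on (ball 0 1) p" using hol by (rule holomorphic_on_imp_continuous_on)
  \<comment> \<open>Restricting to a smaller closed disk makes the set closed, so that it has a point of least modulus.\<close>
  define S where "S = {w \<in> cball 0 (norm z). Re (p w) \<le> 0}"
  have sub: "cball 0 (norm z) \<subseteq> (ball 0 1 :: complex set)" using z by auto
  have "closed (cball 0 (norm z) \<inter> p -` {w. Re w \<le> 0})"
    by (intro continuous_closed_preimage closed_cball closed_halfspace_Re_le
        continuous_on_subset[OF contp sub])
  moreover have "S = cball 0 (norm z) \<inter> p -` {w. Re w \<le> 0}" by (auto simp: S_def)
  ultimately have "closed S" by simp
  moreover have "z \<in> S" using neg by (simp add: S_def)
  ultimately obtain c where c: "c \<in> S" "\<And>w. w \<in> S \<Longrightarrow> norm c \<le> norm w"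
    using distance_attains_inf[of S 0] by (metis dist_0_norm empty_iff)
  have cz: "norm c \<le> norm z" using c(1) by (simp add: S_def)
  have pos: "Re (p w) > 0" if "norm w < norm c" for w
    using c(2)[of w] that cz by (force simp: S_def)
  have c1: "c \<in> ball 0 1" using cz z by simp
  have "c \<noteq> 0" using c(1) p0 by (auto simp: S_def)
  have "Re (p c) \<ge> 0"
    by (rule Re_nonneg_on_circle[OF contp _ c1]) (use pos \<open>c \<noteq> 0\<close> in auto)
  with c(1) have pc: "Re (p c) = 0" by (simp add: S_def)
  have sub': "cball 0 (norm c) \<subseteq> (ball 0 1 :: complex set)" using c1 by auto
  note bounds = first_imaginary_point[OF hol open_ball sub' p0 pos pc]
  define a where "a = Im (p c)"
  define m where "m = Re (c * deriv p c)"
  have m: "m \<le> - (1 + a\<^sup>2) / 2" using bounds(2) by (simp add: m_def a_def)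
  have "c * deriv p c = of_real m" "p c = \<i> * of_real a"
    using bounds(1) pc by (simp_all add: complex_eq_iff m_def a_def)
  then have "c * deriv p c + p c - (p c)\<^sup>2 = Complex (m + a\<^sup>2) a"
    by (simp add: complex_eq_iff power2_eq_square)
  then have "norm (Complex (m + a\<^sup>2) a) < 1 / 2" using small[OF c1] by simp
  then have "(norm (Complex (m + a\<^sup>2) a))\<^sup>2 < (1 / 2)\<^sup>2"
    by (intro power_strict_mono) auto
  then have lt: "(m + a\<^sup>2)\<^sup>2 + a\<^sup>2 < (1 / 2)\<^sup>2" by (simp only: cmod_power2 complex.sel)
  have "(1 / 2)\<^sup>2 < (1::real)" by (simp add: power2_eq_square)
  then have "a\<^sup>2 < 1" using lt zero_le_power2[of "m + a\<^sup>2"] by linarith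
  then have "((1 - a\<^sup>2) / 2)\<^sup>2 \<le> (- (m + a\<^sup>2))\<^sup>2"
    using m by (intro power_mono) (simp_all add: field_simps)
  moreover have "((1 + x) / 2)\<^sup>2 = ((1 - x) / 2)\<^sup>2 + x" for x :: real
    by (simp add: power2_eq_square field_simps)
  ultimately have "((1 + a\<^sup>2) / 2)\<^sup>2 \<le> (m + a\<^sup>2)\<^sup>2 + a\<^sup>2"
    by (simp only: power2_minus add_mono order_refl)
  moreover have "(1 / 2)\<^sup>2 \<le> ((1 + a\<^sup>2) / 2)\<^sup>2" by (intro power_mono) simp_all
  ultimately show False using lt by linarith
qed

section \<open>The quotients of a normalized function\<close>

lemma origin_quot_holomorphic:
  assumes "f \<in> normalized_analytic"
  shows "origin_quot f holomorphic_on unit_disk"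
proof -
  have hol: "f holomorphic_on unit_disk" and f0: "f 0 = 0" "deriv f 0 = 1"
    using assms by (auto simp: normalized_analytic_def analytic_imp_holomorphic)
  have "(\<lambda>z. if z = 0 then deriv f 0 else (f z - f 0) / (z - 0)) holomorphic_on unit_disk"
    by (rule pole_lemma[OF hol]) simp
  then show ?thesis
    by (simp add: f0 origin_quot_def[abs_def] cong: if_cong)
qed

lemma deriv_origin_quot:
  assumes f: "f \<in> normalized_analytic" and z: "z \<in> unit_disk"
  shows "z * deriv (origin_quot f) z + origin_quot f z = deriv f z"
proof -
  have f0: "f 0 = 0" using f by (simp add: normalized_analytic_def)
  have "(origin_quot f has_field_derivative deriv (origin_quot f) z) (at z)"
    using origin_quot_holomorphic[OF f] z by (simp add: holomorphic_derivI)
  then have "((\<lambda>w. w * origin_quot f w) has_field_derivative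
      z * deriv (origin_quot f) z + origin_quot f z) (at z)"
    by (auto intro!: derivative_eq_intros)
  moreover have "(\<lambda>w. w * origin_quot f w) = f"
    using f0 by (auto simp: origin_quot_def)
  ultimately show ?thesis by (simp add: DERIV_imp_deriv)
qed

text \<open>Writing \<open>p = z f' / f\<close> as \<open>f' / q\<close> with \<open>q = f / z\<close> removes the singularity at the origin. The
  quotient rule, with \<open>z q' = f' - q\<close>, gives \<open>z p' = z f'' / q - p\<^sup>2 + p\<close>, and
  \<open>z f'' / q = p (z f'' / f')\<close>.\<close>

lemma log_deriv_quot_properties:
  assumes f: "f \<in> normalized_analytic" and nz: "\<And>z. z \<in> unit_disk - {0} \<Longrightarrow> f z \<noteq> 0"
  shows "log_deriv_quot f holomorphic_on unit_disk"
    and "\<And>z. z \<in> unit_disk \<Longrightarrow> deriv f z \<noteq> 0 \<Longrightarrow>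
      z * deriv (log_deriv_quot f) z + log_deriv_quot f z - (log_deriv_quot f z)\<^sup>2 =
      log_deriv_quot f z * (2 - 2 * log_deriv_quot f z + z * (deriv ^^ 2) f z / deriv f z)"
proof -
  let ?q = "origin_quot f"
  have hol: "f holomorphic_on unit_disk" and f0: "f 0 = 0" "deriv f 0 = 1"
    using f by (auto simp: normalized_analytic_def analytic_imp_holomorphic)
  have hol': "deriv f holomorphic_on unit_disk"
    using hol by (intro holomorphic_deriv) auto
  have qnz: "?q z \<noteq> 0" if "z \<in> unit_disk" for z
    using nz that by (auto simp: origin_quot_def)
  have eq: "log_deriv_quot f = (\<lambda>z. deriv f z / ?q z)"
    by (auto simp: log_deriv_quot_def origin_quot_def f0)
  show "log_deriv_quot f holomorphic_on unit_disk"
    unfolding eq using qnz by (intro holomorphic_on_divide hol' origin_quot_holomorphic[OF f]) auto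
  fix z assume z: "z \<in> unit_disk" and nz': "deriv f z \<noteq> 0"
  have d1: "(deriv f has_field_derivative (deriv ^^ 2) f z) (at z)"
    using holomorphic_derivI[OF hol' _ z] by (simp add: numeral_2_eq_2)
  have d2: "(?q has_field_derivative deriv ?q z) (at z)"
    using origin_quot_holomorphic[OF f] z by (simp add: holomorphic_derivI)
  have "deriv (log_deriv_quot f) z =
      ((deriv ^^ 2) f z * ?q z - deriv f z * deriv ?q z) / (?q z * ?q z)"
    unfolding eq by (rule DERIV_imp_deriv, rule DERIV_divide[OF d1 d2 qnz[OF z]])
  then have "z * deriv (log_deriv_quot f) z =
      (z * (deriv ^^ 2) f z * ?q z - deriv f z * (z * deriv ?q z)) / (?q z * ?q z)"
    by (simp add: algebra_simps)
  also have "z * deriv ?q z = deriv f z - ?q z"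
    using deriv_origin_quot[OF f z] by (simp add: algebra_simps)
  finally have dp: "z * deriv (log_deriv_quot f) z =
      (z * (deriv ^^ 2) f z * ?q z - deriv f z * (deriv f z - ?q z)) / (?q z * ?q z)" .
  show "z * deriv (log_deriv_quot f) z + log_deriv_quot f z - (log_deriv_quot f z)\<^sup>2 =
      log_deriv_quot f z * (2 - 2 * log_deriv_quot f z + z * (deriv ^^ 2) f z / deriv f z)"
    unfolding dp using qnz[OF z] nz' by (simp add: eq field_simps power2_eq_square)
qed

text \<open>With \<open>w = z f'' / f'\<close>, so that \<open>p = 1 + w\<close>, differentiation gives
  \<open>z p' = w + z\<^sup>2 f''' / f' - w\<^sup>2\<close>, while \<open>p - p\<^sup>2 = - w - w\<^sup>2\<close>.\<close>

lemma convexity_quot_properties: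
  assumes hol: "f holomorphic_on A" "open A" and nz: "\<And>z. z \<in> A \<Longrightarrow> deriv f z \<noteq> 0"
  defines "p \<equiv> (\<lambda>z. 1 + z * (deriv ^^ 2) f z / deriv f z)"
  shows "p holomorphic_on A"
    and "\<And>z. z \<in> A \<Longrightarrow> z * deriv p z + p z - (p z)\<^sup>2 =
      z ^ 2 * (deriv ^^ 3) f z / deriv f z - 2 * (z * (deriv ^^ 2) f z / deriv f z) ^ 2"
proof -
  have hol1: "deriv f holomorphic_on A" and hol2: "(deriv ^^ 2) f holomorphic_on A"
    using hol holomorphic_higher_deriv[OF hol, of 2] by (auto intro: holomorphic_deriv)
  show "p holomorphic_on A"
    unfolding p_def using nz
    by (intro holomorphic_on_add holomorphic_on_divide holomorphic_on_mult hol1 hol2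
        holomorphic_on_const holomorphic_on_ident) auto
  fix z assume z: "z \<in> A"
  have d1: "(deriv f has_field_derivative (deriv ^^ 2) f z) (at z)"
    using holomorphic_derivI[OF hol1 hol(2) z] by (simp add: numeral_2_eq_2)
  have d2: "((deriv ^^ 2) f has_field_derivative (deriv ^^ 3) f z) (at z)"
    using holomorphic_derivI[OF hol2 hol(2) z] by (simp add: numeral_2_eq_2 numeral_3_eq_3)
  have dp: "deriv p z = (((deriv ^^ 2) f z + z * (deriv ^^ 3) f z) * deriv f z
      - z * (deriv ^^ 2) f z * (deriv ^^ 2) f z) / (deriv f z * deriv f z)"
    unfolding p_def
    by (rule DERIV_imp_deriv) (rule derivative_eq_intros d1 d2 refl nz z | simp add: nz z)+
  show "z * deriv p z + p z - (p z)\<^sup>2 =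
      z ^ 2 * (deriv ^^ 3) f z / deriv f z - 2 * (z * (deriv ^^ 2) f z / deriv f z) ^ 2"
    unfolding dp using nz[OF z] by (simp add: p_def field_simps power2_eq_square)
qed

section \<open>The four criteria\<close>

theorem corollary2:
  fixes f :: "complex \<Rightarrow> complex"
  assumes "f \<in> normalized_analytic"
  shows
    "((\<forall>z\<in>unit_disk - {0}. f z \<noteq> 0) \<and> (\<forall>z\<in>unit_disk. deriv f z \<noteq> 0) \<and>
      (\<forall>z\<in>unit_disk. norm (log_deriv_quot f z *
         (2 - 2 * log_deriv_quot f z + z * (deriv ^^ 2) f z / deriv f z)) < 1 / 2)
      \<longrightarrow> f \<in> starlike_functions) \<and>
     ((\<forall>z\<in>unit_disk. deriv f z \<noteq> 0) \<and>
      (\<forall>z\<in>unit_disk. norm (z ^ 2 * (deriv ^^ 3) f z / deriv f z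
         - 2 * (z * (deriv ^^ 2) f z / deriv f z) ^ 2) < 1 / 2)
      \<longrightarrow> f \<in> convex_functions) \<and>
     ((\<forall>z\<in>unit_disk. norm (z * (deriv ^^ 2) f z + deriv f z - (deriv f z) ^ 2) < 1 / 2)
      \<longrightarrow> (\<forall>z\<in>unit_disk. Re (deriv f z) > 0)) \<and>
     ((\<forall>z\<in>unit_disk. norm (deriv f z - (origin_quot f z) ^ 2) < 1 / 2)
      \<longrightarrow> (\<forall>z\<in>unit_disk. Re (origin_quot f z) > 0))"
proof (intro conjI impI)
  have hol: "f holomorphic_on unit_disk" and f0: "deriv f 0 = 1"
    using assms by (auto simp: normalized_analytic_def analytic_imp_holomorphic)
  {
    assume A: "(\<forall>z\<in>unit_disk - {0}. f z \<noteq> 0) \<and> (\<forall>z\<in>unit_disk. deriv f z \<noteq> 0) \<and>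
      (\<forall>z\<in>unit_disk. norm (log_deriv_quot f z *
         (2 - 2 * log_deriv_quot f z + z * (deriv ^^ 2) f z / deriv f z)) < 1 / 2)"
    then have nz: "\<And>z. z \<in> unit_disk - {0} \<Longrightarrow> f z \<noteq> 0" by blast
    have "Re (log_deriv_quot f z) > 0" if "z \<in> unit_disk" for z
    proof (rule Re_pos_if_norm_diff_expr_less[OF _ _ _ that])
      show "log_deriv_quot f holomorphic_on unit_disk"
        by (rule log_deriv_quot_properties(1)[OF assms nz])
      show "log_deriv_quot f 0 = 1" by (simp add: log_deriv_quot_def)
      fix w :: complex assume w: "w \<in> unit_disk"
      then have "deriv f w \<noteq> 0" using A by blast
      from log_deriv_quot_properties(2)[OF assms nz w this] A w
      show "norm (w * deriv (log_deriv_quot f) w + log_deriv_quot f w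
          - (log_deriv_quot f w)\<^sup>2) < 1 / 2" by metis
    qed
    then show "f \<in> starlike_functions"
      using assms A unfolding starlike_functions_def by blast
  next
    assume A: "(\<forall>z\<in>unit_disk. deriv f z \<noteq> 0) \<and>
      (\<forall>z\<in>unit_disk. norm (z ^ 2 * (deriv ^^ 3) f z / deriv f z
         - 2 * (z * (deriv ^^ 2) f z / deriv f z) ^ 2) < 1 / 2)"
    then have nz: "\<And>z. z \<in> unit_disk \<Longrightarrow> deriv f z \<noteq> 0" by blast
    have "Re (1 + z * (deriv ^^ 2) f z / deriv f z) > 0" if "z \<in> unit_disk" for z
    proof (rule Re_pos_if_norm_diff_expr_less[OF _ _ _ that])
      show "(\<lambda>z. 1 + z * (deriv ^^ 2) f z / deriv f z) holomorphic_on unit_disk"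
        by (rule convexity_quot_properties(1)[OF hol open_ball nz])
      show "norm (w * deriv (\<lambda>z. 1 + z * (deriv ^^ 2) f z / deriv f z) w
          + (1 + w * (deriv ^^ 2) f w / deriv f w)
          - (1 + w * (deriv ^^ 2) f w / deriv f w)\<^sup>2) < 1 / 2" if w: "w \<in> unit_disk" for w
        using bspec[OF conjunct2[OF A] w] convexity_quot_properties(2)[OF hol open_ball nz w]
        by simp
    qed simp
    then show "f \<in> convex_functions"
      using assms A unfolding convex_functions_def by blast
  next
    assume A: "\<forall>z\<in>unit_disk. norm (z * (deriv ^^ 2) f z + deriv f z - (deriv f z) ^ 2) < 1 / 2"
    show "\<forall>z\<in>unit_disk. Re (deriv f z) > 0"
    proof
      fix z :: complex assume z: "z \<in> unit_disk"
      show "Re (deriv f z) > 0"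
      proof (rule Re_pos_if_norm_diff_expr_less[OF _ _ _ z])
        show "deriv f holomorphic_on unit_disk" by (rule holomorphic_deriv[OF hol open_ball])
        show "norm (w * deriv (deriv f) w + deriv f w - (deriv f w)\<^sup>2) < 1 / 2"
          if w: "w \<in> unit_disk" for w
          using bspec[OF A w] by (simp add: eval_nat_numeral)
      qed (rule f0)
    qed
  next
    assume A: "\<forall>z\<in>unit_disk. norm (deriv f z - (origin_quot f z) ^ 2) < 1 / 2"
    show "\<forall>z\<in>unit_disk. Re (origin_quot f z) > 0"
    proof
      fix z :: complex assume z: "z \<in> unit_disk"
      show "Re (origin_quot f z) > 0"
      proof (rule Re_pos_if_norm_diff_expr_less[OF _ _ _ z])
        show "origin_quot f 0 = 1" by (simp add: origin_quot_def)
        show "norm (w * deriv (origin_quot f) w + origin_quot f w - (origin_quot f w)\<^sup>2) < 1 / 2"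
          if w: "w \<in> unit_disk" for w
          unfolding deriv_origin_quot[OF assms w] using A w by blast
      qed (rule origin_quot_holomorphic[OF assms])
    qed
  }
qed

end
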